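(* Let $G=(V,E)$ be a connected, locally finite graph. Then $p_{2\to 2}(G)\leq p_{\mathrm{exp}}(G)$.
   Context: Bernoulli-$p$ bond percolation on $G$, $p\in[0,1]$: each edge is independently open with probability $p$ and closed otherwise; $G[p]$ is the random subgraph obtained by deleting all closed edges, its connected components are called clusters, and its law is denoted $\mathbf P_p$. Write $u\leftrightarrow v$ if $u$ and $v$ are in the same cluster, and $\tau_p(u,v)=\mathbf P_p(u\leftrightarrow v)$ (so $\tau_p(v,v)=1$). $d$ is the graph distance on $G$. For a matrix $M\in[0,\infty]^{V^2}$ and $q\in[1,\infty]$, $\|M\|_{q\to q}=\sup\{\|Mf\|_q/\|f\|_q : f\in L^q(V),\ f\ge 0,\ f\neq 0\}$, where $L^q(V)$ is with respect to counting measure. $T_p$ is the matrix $T_p(u,v)=\tau_p(u,v)$, and $p_{q\to q}(G)=\sup\{p\in[0,1]:\|T_p\|_{q\to q}<\infty\}$. Define $\xi_p=-\limsup_{n\to\infty}\frac1n\log\sup\{\tau_p(u,v): u,v\in V,\ d(u,v)\ge n\}$ (with $\sup\emptyset=0$ and $\log 0=-\infty$). $G$ has exponential connectivity decay at $p$ if $\xi_p>0$, and $p_{\mathrm{exp}}(G)=\sup\{p\in[0,1]: \xi_p>0\}$. *)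

theory Defs
  imports "HOL-Probability.Probability"
begin

text \<open>
  Undirected graphs, with edges as abstract objects mapped to their sets of endpoints, so that
  parallel edges and loops (singleton endpoint sets) are allowed.  A simple graph is the case
  in which edges are two-element vertex sets and \<open>ends\<close> is the identity.
\<close>

record ('v, 'e) graph =
  verts :: "'v set"
  edges :: "'e set"
  ends  :: "'e \<Rightarrow> 'v set"

definition graph :: "('v, 'e) graph \<Rightarrow> bool" where
  "graph G \<longleftrightarrow> (\<forall>e\<in>edges G. \<exists>u\<in>verts G. \<exists>v\<in>verts G. ends G e = {u, v})"

definition adj :: "('v, 'e) graph \<Rightarrow> ('v \<times> 'v) set" where
  "adj G = {(u, v). u \<in> verts G \<and> v \<in> verts G \<and> (\<exists>e\<in>edges G. ends G e = {u, v})}"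

definition connected_graph :: "('v, 'e) graph \<Rightarrow> bool" where
  "connected_graph G \<longleftrightarrow> verts G \<noteq> {} \<and> (\<forall>u\<in>verts G. \<forall>v\<in>verts G. (u, v) \<in> (adj G)\<^sup>*)"

definition locally_finite_graph :: "('v, 'e) graph \<Rightarrow> bool" where
  "locally_finite_graph G \<longleftrightarrow> (\<forall>v\<in>verts G. finite {e \<in> edges G. v \<in> ends G e})"

text \<open>Only meaningful for \<open>u\<close>, \<open>v\<close> in the same connected component.\<close>

definition graph_dist :: "('v, 'e) graph \<Rightarrow> 'v \<Rightarrow> 'v \<Rightarrow> nat" where
  "graph_dist G u v = (LEAST n. (u, v) \<in> adj G ^^ n)"

text \<open>A configuration \<open>\<omega>\<close> maps open edges to \<open>True\<close> and closed edges to \<open>False\<close>.\<close>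

definition bernoulli_percolation :: "('v, 'e) graph \<Rightarrow> real \<Rightarrow> ('e \<Rightarrow> bool) measure" where
  "bernoulli_percolation G p = (\<Pi>\<^sub>M e\<in>edges G. measure_pmf (bernoulli_pmf p))"

definition open_subgraph :: "('v, 'e) graph \<Rightarrow> ('e \<Rightarrow> bool) \<Rightarrow> ('v, 'e) graph" where
  "open_subgraph G \<omega> = G\<lparr>edges := {e \<in> edges G. \<omega> e}\<rparr>"

definition cluster :: "('v, 'e) graph \<Rightarrow> ('e \<Rightarrow> bool) \<Rightarrow> 'v \<Rightarrow> 'v set" where
  "cluster G \<omega> v = {w \<in> verts G. (v, w) \<in> (adj (open_subgraph G \<omega>))\<^sup>*}"

definition two_point :: "('v, 'e) graph \<Rightarrow> real \<Rightarrow> 'v \<Rightarrow> 'v \<Rightarrow> real" where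
  "two_point G p u v =
     measure (bernoulli_percolation G p)
       {\<omega> \<in> space (bernoulli_percolation G p). v \<in> cluster G \<omega> u}"

text \<open>Powers of extended nonnegative reals, for exponents \<open>a > 0\<close> only.\<close>

definition ennpowr :: "ennreal \<Rightarrow> real \<Rightarrow> ennreal" where
  "ennpowr x a = (if x = \<infinity> then \<infinity> else ennreal (enn2real x powr a))"

definition Lq_norm :: "'v set \<Rightarrow> ennreal \<Rightarrow> ('v \<Rightarrow> ennreal) \<Rightarrow> ennreal" where
  "Lq_norm V q f =
     (if q = \<infinity> then (SUP v\<in>V. f v)
      else ennpowr (\<integral>\<^sup>+ v. ennpowr (f v) (enn2real q) \<partial>count_space V) (1 / enn2real q))"

definition mat_apply :: "'v set \<Rightarrow> ('v \<Rightarrow> 'v \<Rightarrow> ennreal) \<Rightarrow> ('v \<Rightarrow> ennreal) \<Rightarrow> 'v \<Rightarrow> ennreal" where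
  "mat_apply V M f u = (\<integral>\<^sup>+ v. M u v * f v \<partial>count_space V)"

text \<open>The norm \<open>\<parallel>M\<parallel>\<close> from \<open>L\<^sup>q(V)\<close> to itself, for \<open>1 \<le> q \<le> \<infinity>\<close>.\<close>

definition op_norm :: "'v set \<Rightarrow> ennreal \<Rightarrow> ('v \<Rightarrow> 'v \<Rightarrow> ennreal) \<Rightarrow> ennreal" where
  "op_norm V q M =
     Sup {Lq_norm V q (mat_apply V M (\<lambda>v. ennreal (f v))) / Lq_norm V q (\<lambda>v. ennreal (f v)) | f.
            (\<forall>v\<in>V. f v \<ge> 0) \<and> (\<exists>v\<in>V. f v \<noteq> 0) \<and> Lq_norm V q (\<lambda>v. ennreal (f v)) < \<infinity>}"

definition two_point_matrix :: "('v, 'e) graph \<Rightarrow> real \<Rightarrow> 'v \<Rightarrow> 'v \<Rightarrow> ennreal" where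
  "two_point_matrix G p u v = ennreal (two_point G p u v)"

definition p_op :: "ennreal \<Rightarrow> ('v, 'e) graph \<Rightarrow> real" where
  "p_op q G = Sup {p \<in> {0..1}. op_norm (verts G) q (two_point_matrix G p) < \<infinity>}"

definition log_ennreal :: "ennreal \<Rightarrow> ereal" where
  "log_ennreal x = (if x = 0 then -\<infinity> else if x = \<infinity> then \<infinity> else ereal (ln (enn2real x)))"

text \<open>The supremum is taken in \<open>ennreal\<close>, so that the empty supremum is \<open>0\<close>.\<close>

definition decay_rate :: "('v, 'e) graph \<Rightarrow> real \<Rightarrow> ereal" where
  "decay_rate G p =
     - limsup (\<lambda>n. ereal (1 / real n) *
         log_ennreal (Sup {ennreal (two_point G p u v) | u v.
                             u \<in> verts G \<and> v \<in> verts G \<and> graph_dist G u v \<ge> n}))"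

definition exponential_connectivity_decay :: "('v, 'e) graph \<Rightarrow> real \<Rightarrow> bool" where
  "exponential_connectivity_decay G p \<longleftrightarrow> decay_rate G p > 0"

definition p_exp :: "('v, 'e) graph \<Rightarrow> real" where
  "p_exp G = Sup {p \<in> {0..1}. exponential_connectivity_decay G p}"

end

theory Submission
  imports Defs
begin

text \<open>
  Suppose that \<open>T = T\<^sub>p\<close> has finite norm \<open>C\<close> on \<open>L\<^sup>2\<close>; write \<open>B\<^sub>n\<close> and \<open>D\<^sub>n\<close> for the restrictions of
  \<open>T\<close> to the pairs at distance exactly \<open>n\<close> and at least \<open>n\<close>.  The Simon--Lieb inequality says
  \<open>D\<^bsub>n+m\<^esub> \<le> B\<^sub>n D\<^sub>m\<close> entrywise.  Summing \<open>D\<^sub>n \<le> B\<^sub>k T\<close> over \<open>k < n\<close> gives \<open>n D\<^sub>n \<le> T\<^sup>2\<close>, so that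
  \<open>\<parallel>B\<^sub>n\<parallel> \<le> \<parallel>D\<^sub>n\<parallel> \<le> C\<^sup>2 / n\<close>, which is at most \<open>1/2\<close> for some \<open>n\<close>.  Then \<open>D\<^bsub>kn\<^esub> \<le> B\<^sub>n\<^sup>k T\<close> has norm
  at most \<open>2\<^sup>-\<^sup>k C\<close>, and so do its entries: \<open>p\<close> has exponential connectivity decay.
\<close>

section \<open>Independence in product measures\<close>

text \<open>The joint law of the coordinates is \<open>PiM I M\<close> itself, which is the product
  of their marginal laws. The empty index set is split off because this criterion for independence
  requires a nonempty one.\<close>

lemma indep_vars_PiM_coordinates:
  assumes "\<And>i. i \<in> I \<Longrightarrow> prob_space (M i)"
  shows "prob_space.indep_vars (PiM I M) M (\<lambda>i \<omega>. \<omega> i) I"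
proof -
  interpret prob_space "PiM I M" by (rule prob_space_PiM) (use assms in auto)
  show ?thesis
  proof (cases "I = {}")
    case True
    then show ?thesis unfolding indep_vars_def indep_sets_def by auto
  next
    case False
    have "distr (PiM I M) (PiM I M) (\<lambda>x. \<lambda>i\<in>I. x i) = distr (PiM I M) (PiM I M) (\<lambda>x. x)"
      by (rule distr_cong) (auto simp: space_PiM)
    moreover have "(\<Pi>\<^sub>M i\<in>I. distr (PiM I M) (M i) (\<lambda>\<omega>. \<omega> i)) = PiM I M"
      by (rule PiM_cong) (auto intro!: distr_PiM_component assms)
    ultimately show ?thesis
      using False by (subst indep_vars_iff_distr_eq_PiM') (auto simp: distr_id)
  qed
qed

text \<open>The restrictions of \<open>\<omega>\<close> to disjoint index sets are independent.
  Asking that \<open>P\<close> and \<open>Q\<close> ignore restriction lets both events be written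
  directly on the full product space instead of as preimages.\<close>

lemma prob_PiM_disjoint_blocks:
  assumes M: "\<And>i. i \<in> I \<Longrightarrow> prob_space (M i)"
    and sub: "J \<subseteq> I" "K \<subseteq> I" "J \<inter> K = {}"
    and A: "{\<omega> \<in> space (PiM J M). P \<omega>} \<in> sets (PiM J M)"
    and B: "{\<omega> \<in> space (PiM K M). Q \<omega>} \<in> sets (PiM K M)"
    and P: "\<And>\<omega>. P (restrict \<omega> J) \<longleftrightarrow> P \<omega>" and Q: "\<And>\<omega>. Q (restrict \<omega> K) \<longleftrightarrow> Q \<omega>"
  shows "measure (PiM I M) {\<omega> \<in> space (PiM I M). P \<omega> \<and> Q \<omega>} =
    measure (PiM I M) {\<omega> \<in> space (PiM I M). P \<omega>} * measure (PiM I M) {\<omega> \<in> space (PiM I M). Q \<omega>}"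
proof -
  interpret prob_space "PiM I M" by (rule prob_space_PiM) (use M in auto)
  have res: "restrict \<omega> L \<in> space (PiM L M)" if "\<omega> \<in> space (PiM I M)" "L \<subseteq> I" for \<omega> L
    using that by (auto simp: space_PiM PiE_iff)
  have "indep_var (PiM J M) (\<lambda>\<omega>. restrict \<omega> J) (PiM K M) (\<lambda>\<omega>. restrict \<omega> K)"
    using indep_var_restrict[OF indep_vars_PiM_coordinates sub(3,1,2)] M by simp
  from indep_varD[OF this A B]
  have "prob ((\<lambda>\<omega>. (restrict \<omega> J, restrict \<omega> K)) -`
        ({\<omega> \<in> space (PiM J M). P \<omega>} \<times> {\<omega> \<in> space (PiM K M). Q \<omega>}) \<inter> space (PiM I M)) =
      prob ((\<lambda>\<omega>. restrict \<omega> J) -` {\<omega> \<in> space (PiM J M). P \<omega>} \<inter> space (PiM I M)) *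
      prob ((\<lambda>\<omega>. restrict \<omega> K) -` {\<omega> \<in> space (PiM K M). Q \<omega>} \<inter> space (PiM I M))" .
  moreover have "(\<lambda>\<omega>. (restrict \<omega> J, restrict \<omega> K)) -`
        ({\<omega> \<in> space (PiM J M). P \<omega>} \<times> {\<omega> \<in> space (PiM K M). Q \<omega>}) \<inter> space (PiM I M) =
      {\<omega> \<in> space (PiM I M). P \<omega> \<and> Q \<omega>}"
    using sub by (auto simp: P Q intro: res)
  moreover have "(\<lambda>\<omega>. restrict \<omega> J) -` {\<omega> \<in> space (PiM J M). P \<omega>} \<inter> space (PiM I M) =
      {\<omega> \<in> space (PiM I M). P \<omega>}"
    using sub by (auto simp: P intro: res)
  moreover have "(\<lambda>\<omega>. restrict \<omega> K) -` {\<omega> \<in> space (PiM K M). Q \<omega>} \<inter> space (PiM I M) =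
      {\<omega> \<in> space (PiM I M). Q \<omega>}"
    using sub by (auto simp: Q intro: res)
  ultimately show ?thesis by simp
qed

section \<open>Open paths and clusters: measurability and exploration\<close>

text \<open>The edge set \<open>F\<close> is a parameter so that the same notion serves the whole
  graph, a ball, and the edges left unrevealed by an exploration.\<close>

definition open_adj :: "('e \<Rightarrow> 'v set) \<Rightarrow> 'e set \<Rightarrow> ('e \<Rightarrow> bool) \<Rightarrow> ('v \<times> 'v) set" where
  "open_adj en F \<omega> = {(x, y). \<exists>e\<in>F. \<omega> e \<and> en e = {x, y}}"

definition open_cluster :: "('e \<Rightarrow> 'v set) \<Rightarrow> 'e set \<Rightarrow> ('e \<Rightarrow> bool) \<Rightarrow> 'v \<Rightarrow> 'v set" where
  "open_cluster en F \<omega> u = {x. (u, x) \<in> (open_adj en F \<omega>)\<^sup>*}"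

lemma open_adj_restrict: "F \<subseteq> J \<Longrightarrow> open_adj en F (restrict \<omega> J) = open_adj en F \<omega>"
  by (auto simp: open_adj_def)

lemma open_adj_mono: "F \<subseteq> F' \<Longrightarrow> open_adj en F \<omega> \<subseteq> open_adj en F' \<omega>"
  by (auto simp: open_adj_def)

lemma open_cluster_subset:
  assumes "u \<in> B" "\<And>e. e \<in> F \<Longrightarrow> en e \<subseteq> B"
  shows "open_cluster en F \<omega> u \<subseteq> B"
proof
  fix x assume "x \<in> open_cluster en F \<omega> u"
  then have "(u, x) \<in> (open_adj en F \<omega>)\<^sup>*" by (simp add: open_cluster_def)
  then show "x \<in> B"
    by (induction) (use assms in \<open>auto simp: open_adj_def\<close>)
qed

text \<open>Split by path length: a path with n + 1 steps is one with n steps followed by an open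
  edge, and its intermediate vertex ranges over the countable set \<open>W\<close>. Keeping
  \<open>I\<close> apart from \<open>F\<close> makes the result usable on products over blocks of
  edges.\<close>

lemma sets_open_connected:
  fixes M :: "'e \<Rightarrow> bool measure"
  assumes F: "countable F" "F \<subseteq> I" and W: "countable W" "\<And>e. e \<in> F \<Longrightarrow> en e \<subseteq> W"
    and M: "\<And>e. e \<in> I \<Longrightarrow> sets (M e) = UNIV"
  shows "{\<omega> \<in> space (PiM I M). (x, y) \<in> (open_adj en F \<omega>)\<^sup>*} \<in> sets (PiM I M)"
proof -
  have edge: "{\<omega> \<in> space (PiM I M). \<omega> e} \<in> sets (PiM I M)" if "e \<in> F" for e
  proof -
    have "(\<lambda>\<omega>. \<omega> e) -` {True} \<inter> space (PiM I M) \<in> sets (PiM I M)"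
      using that F M by (intro measurable_sets[OF measurable_component_singleton]) auto
    moreover have "(\<lambda>\<omega>. \<omega> e) -` {True} \<inter> space (PiM I M) = {\<omega> \<in> space (PiM I M). \<omega> e}" by auto
    ultimately show ?thesis by simp
  qed
  have step: "{\<omega> \<in> space (PiM I M). (w, y) \<in> open_adj en F \<omega>} \<in> sets (PiM I M)" for w y
    unfolding open_adj_def mem_Collect_eq prod.case
    by (intro sets.sets_Collect_countable_Ex' sets.sets_Collect_conj sets.sets_Collect_const edge F)
  have pow: "{\<omega> \<in> space (PiM I M). (x, y) \<in> open_adj en F \<omega> ^^ n} \<in> sets (PiM I M)" for n y
  proof (induction n arbitrary: y)
    case 0
    show ?case by (auto intro: sets.sets_Collect_const)
  next
    case (Suc n)
    have "(x, y) \<in> open_adj en F \<omega> ^^ Suc n \<longleftrightarrow>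
        (\<exists>w\<in>W. (x, w) \<in> open_adj en F \<omega> ^^ n \<and> (w, y) \<in> open_adj en F \<omega>)" for \<omega>
      using W(2) by (force simp: relcomp_unfold open_adj_def)
    then show ?case
      using Suc step W by (auto intro!: sets.sets_Collect_countable_Ex' sets.sets_Collect_conj)
  qed
  show ?thesis
    unfolding rtrancl_power by (rule sets.sets_Collect_countable_Ex) (rule pow)
qed

text \<open>The cluster stays inside the countable set \<open>W\<close>, so its equality with
  \<open>S\<close> is a countable conjunction of events about single vertices.\<close>

lemma sets_open_cluster_eq:
  fixes M :: "'e \<Rightarrow> bool measure"
  assumes F: "countable F" "F \<subseteq> I" and W: "countable W" "\<And>e. e \<in> F \<Longrightarrow> en e \<subseteq> W"
    and M: "\<And>e. e \<in> I \<Longrightarrow> sets (M e) = UNIV" and S: "S \<subseteq> W" "u \<in> W"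
  shows "{\<omega> \<in> space (PiM I M). open_cluster en F \<omega> u = S} \<in> sets (PiM I M)"
proof -
  have sub: "open_cluster en F \<omega> u \<subseteq> W" for \<omega>
    using S(2) W(2) by (rule open_cluster_subset)
  have "open_cluster en F \<omega> u = S \<longleftrightarrow> (\<forall>x\<in>W. (u, x) \<in> (open_adj en F \<omega>)\<^sup>* \<longleftrightarrow> x \<in> S)" for \<omega>
    using S(1) sub[of \<omega>] by (auto simp: open_cluster_def)
  moreover have "{\<omega> \<in> space (PiM I M). \<forall>x\<in>W. (u, x) \<in> (open_adj en F \<omega>)\<^sup>* \<longleftrightarrow> x \<in> S} \<in> sets (PiM I M)"
  proof (intro sets.sets_Collect_countable_All' W(1))
    fix x
    show "{\<omega> \<in> space (PiM I M). (u, x) \<in> (open_adj en F \<omega>)\<^sup>* \<longleftrightarrow> x \<in> S} \<in> sets (PiM I M)"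
      using sets_open_connected[of F I W en M u x] assms
      by (cases "x \<in> S") (auto intro: sets.sets_Collect_neg)
  qed
  ultimately show ?thesis by simp
qed

text \<open>Exploring a cluster only reveals the edges that touch it.\<close>

lemma open_cluster_eq_iff:
  assumes F': "F' = {e \<in> F. en e \<inter> S \<noteq> {}}"
  shows "open_cluster en F \<omega> u = S \<longleftrightarrow> open_cluster en F' \<omega> u = S"
proof
  assume S: "open_cluster en F \<omega> u = S"
  \<comment> \<open>A path of open \<open>F\<close>-edges from \<open>u\<close> visits only vertices
    of \<open>S\<close>, so each of its edges touches \<open>S\<close> and belongs to
    \<open>F'\<close>.\<close>
  have "(u, x) \<in> (open_adj en F' \<omega>)\<^sup>*" if "(u, x) \<in> (open_adj en F \<omega>)\<^sup>*" for x
    using that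
  proof induction
    case (step y z)
    then have "y \<in> S" using S by (auto simp: open_cluster_def)
    with step have "(y, z) \<in> open_adj en F' \<omega>" by (auto simp: open_adj_def F')
    with step show ?case by (meson rtrancl.rtrancl_into_rtrancl)
  qed simp
  moreover have "(open_adj en F' \<omega>)\<^sup>* \<subseteq> (open_adj en F \<omega>)\<^sup>*"
    by (intro rtrancl_mono open_adj_mono) (auto simp: F')
  ultimately show "open_cluster en F' \<omega> u = S"
    using S unfolding open_cluster_def by blast
next
  assume S: "open_cluster en F' \<omega> u = S"
  \<comment> \<open>Conversely, any open \<open>F\<close>-edge leaving a vertex of \<open>S\<close>
    touches \<open>S\<close>, hence lies in \<open>F'\<close>, and its other end is again in
    \<open>S\<close>.\<close>
  have "x \<in> S" if "(u, x) \<in> (open_adj en F \<omega>)\<^sup>*" for x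
    using that
  proof induction
    case base
    then show ?case using S by (auto simp: open_cluster_def)
  next
    case (step y z)
    then have "(y, z) \<in> open_adj en F' \<omega>" by (auto simp: open_adj_def F')
    with step(3) S show ?case
      unfolding open_cluster_def by (auto intro: rtrancl.rtrancl_into_rtrancl)
  qed
  moreover have "(open_adj en F' \<omega>)\<^sup>* \<subseteq> (open_adj en F \<omega>)\<^sup>*"
    by (intro rtrancl_mono open_adj_mono) (auto simp: F')
  ultimately show "open_cluster en F \<omega> u = S"
    using S unfolding open_cluster_def by blast
qed


section \<open>Distances, countability and two-point functions on a connected locally finite
  graph\<close>

locale percolation_graph =
  fixes G :: "('v, 'e) graph"
  assumes graph: "graph G" and connected: "connected_graph G"
    and locally_finite: "locally_finite_graph G"
begin

lemma ends_subset_verts: "e \<in> edges G \<Longrightarrow> ends G e \<subseteq> verts G"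
  using graph by (auto simp: graph_def)

lemma relpow_graph_dist: "u \<in> verts G \<Longrightarrow> v \<in> verts G \<Longrightarrow> (u, v) \<in> adj G ^^ graph_dist G u v"
  using connected unfolding connected_graph_def graph_dist_def
  by (metis LeastI_ex rtrancl_imp_relpow)

lemma graph_dist_le: "(u, v) \<in> adj G ^^ n \<Longrightarrow> graph_dist G u v \<le> n"
  unfolding graph_dist_def by (rule Least_le)

lemma graph_dist_self [simp]: "graph_dist G u u = 0"
  using graph_dist_le[of u u 0] by simp

lemma graph_dist_triangle:
  assumes "u \<in> verts G" "v \<in> verts G" "w \<in> verts G"
  shows "graph_dist G u w \<le> graph_dist G u v + graph_dist G v w"
  using assms by (intro graph_dist_le) (auto simp: relpow_add intro!: relcompI relpow_graph_dist)

lemma graph_dist_Suc: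
  assumes "u \<in> verts G" "(v, w) \<in> adj G"
  shows "graph_dist G u w \<le> Suc (graph_dist G u v)"
proof (rule graph_dist_le)
  have "v \<in> verts G" using assms by (auto simp: adj_def)
  then show "(u, w) \<in> adj G ^^ Suc (graph_dist G u v)"
    using relpow_graph_dist[OF assms(1)] assms(2) by auto
qed

lemma finite_neighbours: "v \<in> verts G \<Longrightarrow> finite {w. (v, w) \<in> adj G}"
proof -
  assume v: "v \<in> verts G"
  have "finite (\<Union>e\<in>{e \<in> edges G. v \<in> ends G e}. ends G e)"
    using locally_finite graph v by (auto simp: locally_finite_graph_def graph_def)
  moreover have "{w. (v, w) \<in> adj G} \<subseteq> (\<Union>e\<in>{e \<in> edges G. v \<in> ends G e}. ends G e)"
    by (auto simp: adj_def)
  ultimately show ?thesis by (rule rev_finite_subset)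
qed

lemma finite_graph_ball:
  assumes "u \<in> verts G"
  shows "finite {v \<in> verts G. graph_dist G u v \<le> n}"
proof -
  have "finite {v. (u, v) \<in> adj G ^^ k}" for k
  proof (induction k)
    case (Suc k)
    have "{v. (u, v) \<in> adj G ^^ Suc k} = (\<Union>w\<in>{w. (u, w) \<in> adj G ^^ k}. {v. (w, v) \<in> adj G})"
      by auto
    moreover have "finite {v. (w, v) \<in> adj G}" for w
      using finite_neighbours[of w] by (cases "w \<in> verts G") (auto simp: adj_def)
    ultimately show ?case using Suc by simp
  qed simp
  then have "finite (\<Union>k\<le>n. {v. (u, v) \<in> adj G ^^ k})" by simp
  moreover have "{v \<in> verts G. graph_dist G u v \<le> n} \<subseteq> (\<Union>k\<le>n. {v. (u, v) \<in> adj G ^^ k})"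
    using relpow_graph_dist[OF assms] by blast
  ultimately show ?thesis by (rule rev_finite_subset)
qed

text \<open>By connectedness the vertices are exhausted by the finite balls around one of them.
  Countability serves both the measurability of connection events and the exchange of sums over
  vertices.\<close>

lemma countable_verts: "countable (verts G)"
proof -
  obtain u where u: "u \<in> verts G" using connected by (auto simp: connected_graph_def)
  have "countable (\<Union>n. {v \<in> verts G. graph_dist G u v \<le> n})"
    by (intro countable_UN countableI_type countable_finite finite_graph_ball u)
  moreover have "verts G = (\<Union>n. {v \<in> verts G. graph_dist G u v \<le> n})" by auto
  ultimately show ?thesis by simp
qed

lemma countable_edges: "countable (edges G)"
proof -
  have "countable (\<Union>v\<in>verts G. {e \<in> edges G. v \<in> ends G e})"
    using locally_finite
    by (intro countable_UN countable_verts countable_finite) (auto simp: locally_finite_graph_def)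
  moreover have "edges G \<subseteq> (\<Union>v\<in>verts G. {e \<in> edges G. v \<in> ends G e})"
    using graph by (fastforce simp: graph_def)
  ultimately show ?thesis by (rule countable_subset[rotated])
qed

lemma adj_open_subgraph: "adj (open_subgraph G \<omega>) = open_adj (ends G) (edges G) \<omega>"
  using ends_subset_verts by (auto simp: adj_def open_subgraph_def open_adj_def)

lemma mem_cluster_iff:
  "v \<in> cluster G \<omega> u \<longleftrightarrow> v \<in> verts G \<and> (u, v) \<in> (open_adj (ends G) (edges G) \<omega>)\<^sup>*"
  by (simp add: cluster_def adj_open_subgraph)

lemma two_point_eq:
  "v \<in> verts G \<Longrightarrow> two_point G p u v = measure (bernoulli_percolation G p)
    {\<omega> \<in> space (bernoulli_percolation G p). (u, v) \<in> (open_adj (ends G) (edges G) \<omega>)\<^sup>*}"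
  by (simp add: two_point_def mem_cluster_iff)

lemma prob_space_bernoulli_percolation: "prob_space (bernoulli_percolation G p)"
  unfolding bernoulli_percolation_def by (intro prob_space_PiM prob_space_measure_pmf)

lemma sets_connected:
  "F \<subseteq> edges G \<Longrightarrow> {\<omega> \<in> space (bernoulli_percolation G p). (u, v) \<in> (open_adj (ends G) F \<omega>)\<^sup>*}
    \<in> sets (bernoulli_percolation G p)"
  unfolding bernoulli_percolation_def
  by (rule sets_open_connected[where W = "verts G"])
     (use ends_subset_verts countable_edges countable_verts countable_subset in auto)

lemma two_point_self: "v \<in> verts G \<Longrightarrow> two_point G p v v = 1"
  by (simp add: two_point_eq prob_space.prob_space[OF prob_space_bernoulli_percolation])

lemma two_point_nonneg: "0 \<le> two_point G p u v"
  by (simp add: two_point_def)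

section \<open>The Simon--Lieb inequality\<close>

text \<open>
  The vertex \<open>w\<close> is the last vertex of an open path from \<open>u\<close> to \<open>v\<close> that lies in the cluster of \<open>u\<close>
  inside the ball of radius \<open>n\<close>; the next step must leave the ball.
\<close>

lemma connected_exits_cluster:
  fixes n :: nat and u :: 'v
  defines "F \<equiv> {e \<in> edges G. ends G e \<subseteq> {x \<in> verts G. graph_dist G u x \<le> n}}"
  assumes u: "u \<in> verts G" and v: "v \<in> verts G" "n \<le> graph_dist G u v"
    and uv: "(u, v) \<in> (open_adj (ends G) (edges G) \<omega>)\<^sup>*"
  shows "\<exists>w\<in>open_cluster (ends G) F \<omega> u. graph_dist G u w = n \<and>
    (w, v) \<in> (open_adj (ends G) (edges G - {e \<in> F. ends G e \<inter> open_cluster (ends G) F \<omega> u \<noteq> {}}) \<omega>)\<^sup>*"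
    (is "\<exists>w\<in>?S. graph_dist G u w = n \<and> (w, v) \<in> ?R\<^sup>*")
proof -
  have S: "x \<in> verts G \<and> graph_dist G u x \<le> n" if "x \<in> ?S" for x
    using open_cluster_subset[where u = u and B = "{x \<in> verts G. graph_dist G u x \<le> n}" and F = F
        and en = "ends G" and \<omega> = \<omega>] u that
    by (auto simp: F_def)
  have S_step: "y \<in> ?S" if "x \<in> ?S" "(x, y) \<in> open_adj (ends G) F \<omega>" for x y
    using that by (auto simp: open_cluster_def intro: rtrancl.rtrancl_into_rtrancl)
  \<comment> \<open>Induction backwards along the path from \<open>v\<close>: either an exit vertex
    has been found, or the current vertex is outside the cluster and reaches \<open>v\<close> by
    unrevealed edges. At \<open>x = u\<close> the second alternative is impossible.\<close>
  have "(\<exists>w\<in>?S. graph_dist G u w = n \<and> (w, v) \<in> ?R\<^sup>*) \<or> (x \<notin> ?S \<and> (x, v) \<in> ?R\<^sup>*)"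
    if "(x, v) \<in> (open_adj (ends G) (edges G) \<omega>)\<^sup>*" for x
    using that
  proof (induction rule: converse_rtrancl_induct)
    case base
    show ?case
    proof (cases "v \<in> ?S")
      case True
      with S v have "graph_dist G u v = n" by (simp add: le_antisym)
      with True show ?thesis by blast
    qed simp
  next
    case (step x y)
    show ?case
    proof (rule disjCI)
      assume "\<not> (x \<notin> ?S \<and> (x, v) \<in> ?R\<^sup>*)"
      show "\<exists>w\<in>?S. graph_dist G u w = n \<and> (w, v) \<in> ?R\<^sup>*"
      proof (rule ccontr)
        assume no: "\<not> ?thesis"
        then have y: "y \<notin> ?S" "(y, v) \<in> ?R\<^sup>*" using step by auto
        from step obtain e where e: "e \<in> edges G" "\<omega> e" "ends G e = {x, y}"
          by (auto simp: open_adj_def)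
        have eF: "e \<notin> F" if "x \<in> ?S"
          using S_step[OF that, of y] y e by (auto simp: open_adj_def)
        \<comment> \<open>If \<open>x\<close> is in the cluster, then \<open>e\<close> is not in
          \<open>F\<close>, since otherwise \<open>y\<close> would be in the cluster too; if
          \<open>x\<close> is not, neither end of \<open>e\<close> is.\<close>
        have "e \<notin> {e \<in> F. ends G e \<inter> ?S \<noteq> {}}"
          using eF e y by (cases "x \<in> ?S") auto
        then have "(x, y) \<in> ?R" using e unfolding open_adj_def by blast
        with y have xv: "(x, v) \<in> ?R\<^sup>*" by (meson converse_rtrancl_into_rtrancl)
        with \<open>\<not> (x \<notin> ?S \<and> (x, v) \<in> ?R\<^sup>*)\<close> have x: "x \<in> ?S" by blast
        \<comment> \<open>If \<open>x\<close> were strictly inside the ball, both ends of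
          \<open>e\<close> would lie in the ball, which would put \<open>e\<close> into
          \<open>F\<close>.\<close>
        have "graph_dist G u x = n"
        proof (rule ccontr)
          assume "graph_dist G u x \<noteq> n"
          with S[OF x] have "Suc (graph_dist G u x) \<le> n" by simp
          moreover have xy: "(x, y) \<in> adj G"
            using e ends_subset_verts by (auto simp: adj_def)
          ultimately have "graph_dist G u y \<le> n"
            using graph_dist_Suc[OF u xy] by simp
          with S[OF x] xy e have "e \<in> F" by (auto simp: F_def adj_def)
          with eF x show False by blast
        qed
        with x xv no show False by blast
      qed
    qed
  qed
  moreover have "u \<in> ?S" by (simp add: open_cluster_def)
  ultimately show ?thesis using uv by blast
qed

text \<open>
  Condition on the cluster \<open>S\<close> of \<open>u\<close> inside the ball: the rest of the path uses only edges that
  have not been revealed, so independence of disjoint sets of edges suffices and the BK inequality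
  is avoided.
\<close>

lemma simon_lieb:
  assumes u: "u \<in> verts G" and v: "v \<in> verts G" "n \<le> graph_dist G u v"
  shows "two_point G p u v \<le>
    (\<Sum>w | w \<in> verts G \<and> graph_dist G u w = n. two_point G p u w * two_point G p w v)"
proof -
  let ?M = "bernoulli_percolation G p"
  interpret prob_space ?M by (rule prob_space_bernoulli_percolation)
  \<comment> \<open>\<open>B\<close> is the ball, \<open>F\<close> its edges, \<open>T S\<close> the
    edges revealed when the cluster is \<open>S\<close>, \<open>W\<close> the sphere,
    \<open>C S\<close> the event that the explored cluster is \<open>S\<close>, and
    \<open>X x y K\<close> the connection of \<open>x\<close> to \<open>y\<close> within
    \<open>K\<close>.\<close>
  define B where "B = {x \<in> verts G. graph_dist G u x \<le> n}"
  define F where "F = {e \<in> edges G. ends G e \<subseteq> B}"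
  define T where "T S = {e \<in> F. ends G e \<inter> S \<noteq> {}}" for S
  define W where "W = {w \<in> verts G. graph_dist G u w = n}"
  define C where "C S = {\<omega> \<in> space ?M. open_cluster (ends G) F \<omega> u = S}" for S
  define X where "X x y K = {\<omega> \<in> space ?M. (x, y) \<in> (open_adj (ends G) K \<omega>)\<^sup>*}" for x y K
  have B: "finite B" unfolding B_def by (rule finite_graph_ball[OF u])
  have "W \<subseteq> B" by (auto simp: W_def B_def)
  with B have W: "W \<subseteq> B" "finite W" by (auto intro: finite_subset)
  have F: "F \<subseteq> edges G" by (auto simp: F_def)
  have T: "T S \<subseteq> F" for S by (auto simp: T_def)
  have cl: "open_cluster (ends G) F \<omega> u \<subseteq> B" for \<omega>
    by (rule open_cluster_subset) (use u in \<open>auto simp: F_def B_def\<close>)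
  have sX: "X x y K \<in> events" if "K \<subseteq> edges G" for x y K
    unfolding X_def by (rule sets_connected[OF that])
  have sC': "{\<omega> \<in> space (\<Pi>\<^sub>M e\<in>J. measure_pmf (bernoulli_pmf p)). open_cluster (ends G) K \<omega> u = S}
      \<in> sets (\<Pi>\<^sub>M e\<in>J. measure_pmf (bernoulli_pmf p))"
    if "S \<subseteq> B" "K \<subseteq> J" "K \<subseteq> edges G" for S J K
    by (rule sets_open_cluster_eq[where W = "verts G"])
      (use that u countable_edges countable_verts in
        \<open>auto simp: B_def intro: countable_subset dest!: subsetD[OF ends_subset_verts, rotated]\<close>)
  have sC: "C S \<in> events" if "S \<subseteq> B" for S
    using sC'[OF that F F] by (simp add: C_def bernoulli_percolation_def)
  \<comment> \<open>By \<open>open_cluster_eq_iff\<close>, \<open>C S\<close> is determined by the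
    edges in \<open>T S\<close>, while the other event only involves edges outside
    \<open>T S\<close>.\<close>
  have indep: "prob (C S \<inter> X w v (edges G - T S)) = prob (C S) * prob (X w v (edges G - T S))"
    if S: "S \<subseteq> B" for S w
  proof -
    have TS: "T S \<subseteq> edges G" using T F by blast
    have "{\<omega> \<in> space (\<Pi>\<^sub>M e\<in>edges G - T S. measure_pmf (bernoulli_pmf p)).
        (w, v) \<in> (open_adj (ends G) (edges G - T S) \<omega>)\<^sup>*}
        \<in> sets (\<Pi>\<^sub>M e\<in>edges G - T S. measure_pmf (bernoulli_pmf p))"
      by (rule sets_open_connected[where W = "verts G"])
         (use ends_subset_verts countable_edges countable_verts in \<open>auto intro: countable_subset\<close>)
    then have "prob {\<omega> \<in> space ?M. open_cluster (ends G) (T S) \<omega> u = S \<and>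
        (w, v) \<in> (open_adj (ends G) (edges G - T S) \<omega>)\<^sup>*} =
      prob {\<omega> \<in> space ?M. open_cluster (ends G) (T S) \<omega> u = S} * prob (X w v (edges G - T S))"
      unfolding X_def bernoulli_percolation_def
      by (intro prob_PiM_disjoint_blocks[where J = "T S" and K = "edges G - T S"]
            prob_space_measure_pmf sC' S TS order_refl)
         (auto simp: open_adj_restrict open_cluster_def)
    moreover have "C S \<inter> X w v (edges G - T S) = {\<omega> \<in> space ?M. open_cluster (ends G) (T S) \<omega> u = S \<and>
        (w, v) \<in> (open_adj (ends G) (edges G - T S) \<omega>)\<^sup>*}"
      by (auto simp: C_def X_def open_cluster_eq_iff[OF T_def])
    moreover have "C S = {\<omega> \<in> space ?M. open_cluster (ends G) (T S) \<omega> u = S}"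
      by (auto simp: C_def open_cluster_eq_iff[OF T_def])
    ultimately show ?thesis by simp
  qed
  have "two_point G p u v = prob (X u v (edges G))"
    by (simp add: two_point_eq v X_def)
  \<comment> \<open>Union bound over the exit vertex \<open>w\<close> and over the finitely many
    possible clusters \<open>S\<close> containing \<open>w\<close>.\<close>
  also have "\<dots> \<le> prob (\<Union>w\<in>W. \<Union>S\<in>{S \<in> Pow B. w \<in> S}. C S \<inter> X w v (edges G - T S))"
  proof (rule finite_measure_mono)
    show "X u v (edges G) \<subseteq> (\<Union>w\<in>W. \<Union>S\<in>{S \<in> Pow B. w \<in> S}. C S \<inter> X w v (edges G - T S))"
    proof
      fix \<omega> assume \<omega>: "\<omega> \<in> X u v (edges G)"
      let ?S = "open_cluster (ends G) F \<omega> u"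
      obtain w where w: "w \<in> ?S" "graph_dist G u w = n"
        "(w, v) \<in> (open_adj (ends G) (edges G - T ?S) \<omega>)\<^sup>*"
        using connected_exits_cluster[OF u v, of \<omega>] \<omega> unfolding X_def F_def B_def T_def by auto
      then have "w \<in> W" using cl by (auto simp: W_def B_def)
      with w \<omega> cl show "\<omega> \<in> (\<Union>w\<in>W. \<Union>S\<in>{S \<in> Pow B. w \<in> S}. C S \<inter> X w v (edges G - T S))"
        by (auto simp: C_def X_def)
    qed
    show "(\<Union>w\<in>W. \<Union>S\<in>{S \<in> Pow B. w \<in> S}. C S \<inter> X w v (edges G - T S)) \<in> events"
      using W B sX sC by (intro sets.finite_UN) auto
  qed
  also have "\<dots> \<le> (\<Sum>w\<in>W. prob (\<Union>S\<in>{S \<in> Pow B. w \<in> S}. C S \<inter> X w v (edges G - T S)))"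
    using W B sX sC by (intro finite_measure_subadditive_finite) (auto intro!: sets.finite_UN)
  also have "\<dots> \<le> (\<Sum>w\<in>W. \<Sum>S\<in>{S \<in> Pow B. w \<in> S}. prob (C S \<inter> X w v (edges G - T S)))"
    using B sX sC by (intro sum_mono finite_measure_subadditive_finite) auto
  also have "\<dots> \<le> (\<Sum>w\<in>W. \<Sum>S\<in>{S \<in> Pow B. w \<in> S}. prob (C S) * two_point G p w v)"
  proof (intro sum_mono)
    fix w S assume "w \<in> W" and S: "S \<in> {S \<in> Pow B. w \<in> S}"
    have "X w v (edges G - T S) \<subseteq> X w v (edges G)"
      using rtrancl_mono[OF open_adj_mono[of "edges G - T S" "edges G"]] by (fastforce simp: X_def)
    then have "prob (X w v (edges G - T S)) \<le> two_point G p w v"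
      unfolding two_point_eq[OF v(1)] X_def[symmetric] by (intro finite_measure_mono sX) auto
    with S show "prob (C S \<inter> X w v (edges G - T S)) \<le> prob (C S) * two_point G p w v"
      by (simp add: indep mult_left_mono)
  qed
  also have "\<dots> \<le> (\<Sum>w\<in>W. two_point G p u w * two_point G p w v)"
  proof (intro sum_mono)
    fix w assume w: "w \<in> W"
    \<comment> \<open>The events \<open>C S\<close> are disjoint for distinct \<open>S\<close>, and
      those with \<open>w\<close> in \<open>S\<close> all imply that \<open>u\<close> is connected
      to \<open>w\<close>.\<close>
    have "(\<Sum>S\<in>{S \<in> Pow B. w \<in> S}. prob (C S)) = prob (\<Union>S\<in>{S \<in> Pow B. w \<in> S}. C S)"
      using B sC by (intro finite_measure_finite_Union[symmetric])
        (auto simp: disjoint_family_on_def C_def)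
    also have "\<dots> \<le> prob (X u w (edges G))"
      using rtrancl_mono[OF open_adj_mono[OF F]]
      by (intro finite_measure_mono sX) (fastforce simp: C_def X_def open_cluster_def)+
    also have "\<dots> = two_point G p u w" using w by (simp add: two_point_eq X_def W_def)
    finally show "(\<Sum>S\<in>{S \<in> Pow B. w \<in> S}. prob (C S) * two_point G p w v) \<le>
        two_point G p u w * two_point G p w v"
      unfolding sum_distrib_right[symmetric] by (intro mult_right_mono two_point_nonneg)
  qed
  finally show ?thesis by (simp add: W_def)
qed

end


section \<open>Nonnegative matrices acting on square-summable functions\<close>

lemma mat_apply_mono:
  "(\<And>v. v \<in> V \<Longrightarrow> A u v \<le> B u v) \<Longrightarrow> mat_apply V A f u \<le> mat_apply V B f u"
  unfolding mat_apply_def by (intro nn_integral_mono) (auto intro!: mult_right_mono)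

text \<open>Tonelli: the double sum over a countable set may be reordered, so an entrywise bound by
  a matrix product becomes a bound by successive applications.\<close>

lemma mat_apply_le_compose:
  assumes V: "countable V" and u: "u \<in> V"
    and le: "\<And>v. v \<in> V \<Longrightarrow> A u v \<le> (\<integral>\<^sup>+ w. P u w * Q w v \<partial>count_space V)"
  shows "mat_apply V A f u \<le> mat_apply V P (mat_apply V Q f) u"
proof -
  interpret sigma_finite_measure "count_space V"
    by (rule sigma_finite_measure_count_space_countable[OF V])
  interpret pair_sigma_finite "count_space V" "count_space V" ..
  have "mat_apply V A f u \<le> (\<integral>\<^sup>+ v. (\<integral>\<^sup>+ w. P u w * Q w v \<partial>count_space V) * f v \<partial>count_space V)"
    unfolding mat_apply_def by (intro nn_integral_mono mult_right_mono le) auto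
  also have "\<dots> = (\<integral>\<^sup>+ v. \<integral>\<^sup>+ w. P u w * Q w v * f v \<partial>count_space V \<partial>count_space V)"
    by (intro nn_integral_cong nn_integral_multc[symmetric]) auto
  also have "\<dots> = (\<integral>\<^sup>+ w. \<integral>\<^sup>+ v. P u w * Q w v * f v \<partial>count_space V \<partial>count_space V)"
    by (intro Fubini') (simp add: pair_measure_countable V)
  also have "\<dots> = (\<integral>\<^sup>+ w. P u w * (\<integral>\<^sup>+ v. Q w v * f v \<partial>count_space V) \<partial>count_space V)"
    by (intro nn_integral_cong) (simp add: mult.assoc nn_integral_cmult)
  finally show ?thesis by (simp add: mat_apply_def)
qed

text \<open>This is the squared norm of L^2. Working with squares keeps roots of extended reals out
  of the estimates.\<close>

definition sq_norm :: "'v set \<Rightarrow> ('v \<Rightarrow> ennreal) \<Rightarrow> ennreal" where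
  "sq_norm V f = (\<integral>\<^sup>+ v. (f v)\<^sup>2 \<partial>count_space V)"

lemma sq_norm_mono: "(\<And>v. v \<in> V \<Longrightarrow> f v \<le> g v) \<Longrightarrow> sq_norm V f \<le> sq_norm V g"
  unfolding sq_norm_def by (intro nn_integral_mono power_mono) auto

lemma sq_norm_cmult: "sq_norm V (\<lambda>v. c * f v) = c\<^sup>2 * sq_norm V f"
  unfolding sq_norm_def power_mult_distrib by (intro nn_integral_cmult) auto

lemma le_sq_norm: "v \<in> V \<Longrightarrow> (f v)\<^sup>2 \<le> sq_norm V f"
  unfolding sq_norm_def by (rule nn_integral_ge_point)

lemma ennpowr_2: "ennpowr x 2 = x\<^sup>2"
  by (cases x) (auto simp: ennpowr_def ennreal_power infinity_ennreal_def)

lemma ennpowr_half_sq: "(ennpowr x (1 / 2))\<^sup>2 = x"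
  by (cases x) (auto simp: ennpowr_def ennreal_power infinity_ennreal_def powr_half_sqrt)

lemma Lq_norm_2_sq: "(Lq_norm V 2 f)\<^sup>2 = sq_norm V f"
proof -
  have "(2::ennreal) \<noteq> \<infinity>" "enn2real 2 = 2" by simp_all
  then show ?thesis
    unfolding Lq_norm_def sq_norm_def by (simp only: if_False ennpowr_2 ennpowr_half_sq)
qed

text \<open>\<open>op_norm\<close> tests only real-valued, nonzero functions of finite norm; this
  extends the bound to every \<open>f\<close>, in squared form. Having \<open>K\<close> at least 1
  makes the bound trivial when the norm of \<open>f\<close> is infinite.\<close>

lemma op_norm_2_bound:
  assumes fin: "op_norm V 2 M < \<infinity>"
  shows "\<exists>K\<ge>1. \<forall>f. sq_norm V (mat_apply V M f) \<le> ennreal K * sq_norm V f"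
proof -
  obtain C where C: "0 \<le> C" "op_norm V 2 M = ennreal C"
    using fin by (cases "op_norm V 2 M") auto
  have K: "sq_norm V (mat_apply V M f) \<le> ennreal (max 1 (C\<^sup>2)) * sq_norm V f" for f
  proof (cases "sq_norm V f = \<infinity>")
    case True
    then show ?thesis by (simp add: ennreal_mult_top)
  next
    case False
    define g where "g v = enn2real (f v)" for v
    \<comment> \<open>A finite sum of squares forces every value on \<open>V\<close> to be finite,
      so \<open>f\<close> agrees there with the real function \<open>g\<close>.\<close>
    have fg: "f v = ennreal (g v)" if "v \<in> V" for v
    proof -
      have "f v \<noteq> \<top>"
        using le_sq_norm[OF that, of f] False
        by (auto simp: top_unique power2_eq_square)
      then show ?thesis by (simp add: g_def less_top)
    qed
    have app: "mat_apply V M f = mat_apply V M (\<lambda>v. ennreal (g v))"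
      unfolding mat_apply_def by (intro ext nn_integral_cong) (simp add: fg)
    have nrm: "sq_norm V f = sq_norm V (\<lambda>v. ennreal (g v))"
      unfolding sq_norm_def by (intro nn_integral_cong) (simp add: fg)
    show ?thesis
    proof (cases "\<exists>v\<in>V. g v \<noteq> 0")
      case False
      then have "mat_apply V M f = (\<lambda>_. 0)"
        unfolding app mat_apply_def by (intro ext) (auto simp: nn_integral_0_iff_AE AE_count_space)
      then show ?thesis by (simp add: sq_norm_def)
    next
      case True
      let ?x = "Lq_norm V 2 (mat_apply V M (\<lambda>v. ennreal (g v)))"
      let ?y = "Lq_norm V 2 (\<lambda>v. ennreal (g v))"
      have y2: "?y\<^sup>2 \<noteq> \<top>" using False unfolding Lq_norm_2_sq nrm by simp
      then have y: "?y < \<top>" by (auto simp: less_top power2_eq_square ennreal_mult_eq_top_iff)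
      have "?y \<noteq> 0"
      proof
        assume "?y = 0"
        then have "?y\<^sup>2 = 0" by simp
        moreover from True obtain v where v: "v \<in> V" "g v \<noteq> 0" by blast
        moreover have "g v \<ge> 0" by (simp add: g_def)
        ultimately show False
          using le_sq_norm[OF v(1), of "\<lambda>v. ennreal (g v)"] unfolding Lq_norm_2_sq by simp
      qed
      have "?x / ?y \<le> op_norm V 2 M"
        unfolding op_norm_def using True y by (intro Sup_upper) (auto simp: g_def intro!: exI[of _ g])
      then have "?x / ?y * ?y \<le> ennreal C * ?y" using C by (simp add: mult_right_mono)
      moreover have "?x / ?y * ?y = ?x"
        using \<open>?y \<noteq> 0\<close> y by (simp add: ennreal_divide_times)
      ultimately have "?x\<^sup>2 \<le> (ennreal C * ?y)\<^sup>2" by (simp add: power_mono)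
      also have "\<dots> = ennreal (C\<^sup>2) * ?y\<^sup>2" using C by (simp add: power_mult_distrib ennreal_power)
      also have "\<dots> \<le> ennreal (max 1 (C\<^sup>2)) * ?y\<^sup>2" by (intro mult_right_mono ennreal_leI) auto
      finally show ?thesis unfolding Lq_norm_2_sq nrm app .
    qed
  qed
  then show ?thesis by (intro exI[of _ "max 1 (C\<^sup>2)"]) auto
qed

lemma log_ennreal_le:
  assumes "x \<le> ennreal c" "0 < c"
  shows "log_ennreal x \<le> ereal (ln c)"
proof -
  obtain r where r: "x = ennreal r" "0 \<le> r" "r \<le> c"
    using assms by (cases x) (auto simp: top_unique)
  then show ?thesis using assms by (auto simp: log_ennreal_def)
qed

section \<open>From boundedness on L^2 to exponential decay\<close>

context percolation_graph
begin

definition sphere_matrix :: "real \<Rightarrow> nat \<Rightarrow> 'v \<Rightarrow> 'v \<Rightarrow> ennreal" where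
  "sphere_matrix p n u v = (if graph_dist G u v = n then two_point_matrix G p u v else 0)"

definition tail_matrix :: "real \<Rightarrow> nat \<Rightarrow> 'v \<Rightarrow> 'v \<Rightarrow> ennreal" where
  "tail_matrix p n u v = (if n \<le> graph_dist G u v then two_point_matrix G p u v else 0)"

text \<open>Simon--Lieb on the sphere of radius \<open>n\<close>. By the triangle inequality its
  vertices are still at distance at least \<open>m\<close> from \<open>v\<close>, so the second
  factor may be truncated to the tail.\<close>

lemma tail_matrix_add_le:
  assumes u: "u \<in> verts G" and v: "v \<in> verts G"
  shows "tail_matrix p (n + m) u v \<le>
    (\<integral>\<^sup>+ w. sphere_matrix p n u w * tail_matrix p m w v \<partial>count_space (verts G))"
proof (cases "n + m \<le> graph_dist G u v")
  case True
  let ?W = "{w \<in> verts G. graph_dist G u w = n}"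
  have W: "finite ?W"
    by (rule finite_subset[OF _ finite_graph_ball[OF u, of n]]) auto
  have "tail_matrix p (n + m) u v = ennreal (two_point G p u v)"
    using True by (simp add: tail_matrix_def two_point_matrix_def)
  also have "\<dots> \<le> ennreal (\<Sum>w\<in>?W. two_point G p u w * two_point G p w v)"
    using simon_lieb[OF u v, of n p] True by (intro ennreal_leI) auto
  also have "\<dots> = (\<Sum>w\<in>?W. sphere_matrix p n u w * tail_matrix p m w v)"
  proof -
    have "m \<le> graph_dist G w v" if "w \<in> ?W" for w
      using graph_dist_triangle[OF u _ v, of w] that True by auto
    then show ?thesis
      by (subst sum_ennreal[symmetric])
        (auto simp: sphere_matrix_def tail_matrix_def two_point_matrix_def two_point_nonneg
          ennreal_mult intro!: sum.cong)
  qed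
  also have "\<dots> = (\<integral>\<^sup>+ w. sphere_matrix p n u w * tail_matrix p m w v \<partial>count_space (verts G))"
    using W by (intro nn_integral_count_space'[symmetric]) (auto simp: sphere_matrix_def)
  finally show ?thesis .
qed (simp add: tail_matrix_def)

text \<open>Each radius \<open>k < n\<close> bounds the tail by a product of a sphere matrix with T.
  Spheres of different radii are disjoint, so these sphere matrices add up to at most T.\<close>

lemma mult_tail_matrix_le:
  assumes u: "u \<in> verts G" and v: "v \<in> verts G"
  shows "of_nat n * tail_matrix p n u v \<le>
    (\<integral>\<^sup>+ w. two_point_matrix G p u w * two_point_matrix G p w v \<partial>count_space (verts G))"
proof -
  have "of_nat n * tail_matrix p n u v = (\<Sum>k<n. tail_matrix p n u v)" by simp
  also have "\<dots> \<le> (\<Sum>k<n. \<integral>\<^sup>+ w. sphere_matrix p k u w * two_point_matrix G p w v \<partial>count_space (verts G))"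
  proof (intro sum_mono)
    fix k assume "k \<in> {..<n}"
    then have "tail_matrix p n u v \<le> tail_matrix p (k + 0) u v" by (auto simp: tail_matrix_def)
    also note tail_matrix_add_le[OF u v]
    finally show "tail_matrix p n u v \<le>
        (\<integral>\<^sup>+ w. sphere_matrix p k u w * two_point_matrix G p w v \<partial>count_space (verts G))"
      by (simp add: tail_matrix_def)
  qed
  also have "\<dots> = (\<integral>\<^sup>+ w. (\<Sum>k<n. sphere_matrix p k u w) * two_point_matrix G p w v \<partial>count_space (verts G))"
    by (simp add: nn_integral_sum sum_distrib_right)
  also have "\<dots> \<le> (\<integral>\<^sup>+ w. two_point_matrix G p u w * two_point_matrix G p w v \<partial>count_space (verts G))"
    by (intro nn_integral_mono mult_right_mono) (auto simp: sphere_matrix_def sum.delta)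
  finally show ?thesis .
qed

lemma two_point_exponential_bound:
  assumes fin: "op_norm (verts G) 2 (two_point_matrix G p) < \<infinity>"
  shows "\<exists>K\<ge>1. \<exists>n\<ge>1. \<forall>k. \<forall>u\<in>verts G. \<forall>v\<in>verts G.
    k * n \<le> graph_dist G u v \<longrightarrow> two_point G p u v \<le> K / 2 ^ k"
proof -
  let ?V = "verts G" and ?T = "two_point_matrix G p"
  obtain K where K: "K \<ge> 1" and T: "\<And>f. sq_norm ?V (mat_apply ?V ?T f) \<le> ennreal K * sq_norm ?V f"
    using op_norm_2_bound[OF fin] by blast
  \<comment> \<open>\<open>K\<close> bounds the square of the norm of T, so
    \<open>tail_matrix p n\<close> has norm at most \<open>K / n\<close>, which this choice makes at
    most 1/2.\<close>
  define n where "n = nat \<lceil>2 * K\<rceil>"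
  have n: "2 * K \<le> real n" unfolding n_def by linarith
  have n1: "n \<ge> 1" using n K by linarith
  \<comment> \<open>The factor 4 is the squared form of the norm bound 1/2.\<close>
  have sphere: "4 * sq_norm ?V (mat_apply ?V (sphere_matrix p n) f) \<le> sq_norm ?V f" for f
  proof -
    have "of_nat n * mat_apply ?V (tail_matrix p n) f u \<le> mat_apply ?V ?T (mat_apply ?V ?T f) u"
      if "u \<in> ?V" for u
    proof -
      have "of_nat n * mat_apply ?V (tail_matrix p n) f u =
          mat_apply ?V (\<lambda>u v. of_nat n * tail_matrix p n u v) f u"
        unfolding mat_apply_def by (simp add: nn_integral_cmult mult.assoc)
      then show ?thesis
        using mat_apply_le_compose[OF countable_verts that, where P = ?T and Q = ?T]
          mult_tail_matrix_le[OF that] by simp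
    qed
    then have "(of_nat n)\<^sup>2 * sq_norm ?V (mat_apply ?V (tail_matrix p n) f) \<le>
        sq_norm ?V (mat_apply ?V ?T (mat_apply ?V ?T f))"
      unfolding sq_norm_cmult[symmetric] by (rule sq_norm_mono)
    also have "\<dots> \<le> ennreal K * (ennreal K * sq_norm ?V f)"
      by (rule order_trans[OF T mult_left_mono[OF T]]) simp
    also have "\<dots> = ennreal (K\<^sup>2) * sq_norm ?V f"
      using K by (simp add: ennreal_mult' power2_eq_square mult.assoc)
    finally have tail: "(of_nat n)\<^sup>2 * sq_norm ?V (mat_apply ?V (tail_matrix p n) f) \<le>
        ennreal (K\<^sup>2) * sq_norm ?V f" .
    \<comment> \<open>The factor \<open>ennreal (K\<^sup>2)\<close> is put on both sides in order to
      be cancelled, which is legitimate since it is finite and nonzero.\<close>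
    have "ennreal (K\<^sup>2) * 4 = ennreal ((2 * K)\<^sup>2)"
      by (simp add: power_mult_distrib ennreal_mult'' mult.commute)
    also have "\<dots> \<le> ennreal ((real n)\<^sup>2)" using n K by (intro ennreal_leI power_mono) auto
    also have "\<dots> = (of_nat n)\<^sup>2" by (simp add: ennreal_power[symmetric] ennreal_of_nat_eq_real_of_nat)
    finally have "ennreal (K\<^sup>2) * 4 * sq_norm ?V (mat_apply ?V (sphere_matrix p n) f) \<le>
        (of_nat n)\<^sup>2 * sq_norm ?V (mat_apply ?V (tail_matrix p n) f)"
      by (intro mult_mono sq_norm_mono mat_apply_mono) (auto simp: sphere_matrix_def tail_matrix_def)
    also note tail
    finally have "ennreal (K\<^sup>2) * (4 * sq_norm ?V (mat_apply ?V (sphere_matrix p n) f)) \<le>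
        ennreal (K\<^sup>2) * sq_norm ?V f"
      by (simp only: mult.assoc)
    then show ?thesis
      using K by (subst (asm) ennreal_mult_le_mult_iff) auto
  qed
  \<comment> \<open>Each further block of \<open>n\<close> steps in distance costs one application
    of \<open>sphere_matrix p n\<close>, hence a factor 1/4 in the squared norm.\<close>
  have iter: "4 ^ k * sq_norm ?V (mat_apply ?V (tail_matrix p (k * n)) f) \<le> ennreal K * sq_norm ?V f" for k f
  proof (induction k)
    case 0
    have "tail_matrix p 0 = ?T" by (simp add: fun_eq_iff tail_matrix_def)
    then show ?case using T by simp
  next
    case (Suc k)
    have "mat_apply ?V (tail_matrix p (Suc k * n)) f u \<le>
        mat_apply ?V (sphere_matrix p n) (mat_apply ?V (tail_matrix p (k * n)) f) u" if "u \<in> ?V" for u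
      using tail_matrix_add_le[OF that, where n = n and m = "k * n"]
      by (intro mat_apply_le_compose countable_verts that) simp
    then have "4 ^ Suc k * sq_norm ?V (mat_apply ?V (tail_matrix p (Suc k * n)) f) \<le>
        4 ^ k * (4 * sq_norm ?V (mat_apply ?V (sphere_matrix p n) (mat_apply ?V (tail_matrix p (k * n)) f)))"
      by (simp add: sq_norm_mono mult_left_mono mult.assoc mult.left_commute)
    also have "\<dots> \<le> 4 ^ k * sq_norm ?V (mat_apply ?V (tail_matrix p (k * n)) f)"
      by (intro mult_left_mono sphere) simp
    also note Suc
    finally show ?case .
  qed
  have "two_point G p u v \<le> K / 2 ^ k"
    if u: "u \<in> ?V" and v: "v \<in> ?V" and d: "k * n \<le> graph_dist G u v" for k u v
  proof -
    \<comment> \<open>Testing on the unit vector at \<open>v\<close> and evaluating at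
      \<open>u\<close> reads off a single matrix entry.\<close>
    have app: "mat_apply ?V (tail_matrix p (k * n)) (indicator {v}) u = ennreal (two_point G p u v)"
      unfolding mat_apply_def using v d
      by (subst nn_integral_indicator_singleton) (auto simp: tail_matrix_def two_point_matrix_def)
    have "sq_norm ?V (indicator {v}) = (\<integral>\<^sup>+ w. indicator {v} w \<partial>count_space ?V)"
      unfolding sq_norm_def by (intro nn_integral_cong) (auto simp: indicator_def)
    then have one: "sq_norm ?V (indicator {v}) = 1" using v by simp
    have "ennreal ((2 ^ k * two_point G p u v)\<^sup>2) = 4 ^ k * (ennreal (two_point G p u v))\<^sup>2"
    proof -
      have "(2 ^ k * two_point G p u v)\<^sup>2 = 4 ^ k * (two_point G p u v)\<^sup>2"
        by (simp add: power_mult_distrib power2_eq_square flip: power_mult_distrib)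
      then show ?thesis
        by (simp add: ennreal_mult ennreal_power two_point_nonneg flip: ennreal_power)
    qed
    also have "\<dots> \<le> 4 ^ k * sq_norm ?V (mat_apply ?V (tail_matrix p (k * n)) (indicator {v}))"
      using le_sq_norm[OF u, of "mat_apply ?V (tail_matrix p (k * n)) (indicator {v})"]
      by (simp add: app mult_left_mono)
    also have "\<dots> \<le> ennreal K" using iter[of k "indicator {v}"] by (simp add: one)
    finally have "(2 ^ k * two_point G p u v)\<^sup>2 \<le> K" using K by simp
    \<comment> \<open>Since \<open>K\<close> is at least 1, weakening to a perfect square allows the
      root to be taken with the bound \<open>K\<close>.\<close>
    also have "K \<le> K\<^sup>2" using K by (simp add: power2_eq_square)
    finally have "2 ^ k * two_point G p u v \<le> K" using K by (simp add: abs_le_square_iff[symmetric])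
    then show ?thesis by (simp add: field_simps)
  qed
  then show ?thesis using K n1 by blast
qed

lemma exponential_connectivity_decayI:
  assumes K: "K \<ge> 1" and n: "n \<ge> 1"
    and bound: "\<And>k u v. u \<in> verts G \<Longrightarrow> v \<in> verts G \<Longrightarrow> k * n \<le> graph_dist G u v \<Longrightarrow>
      two_point G p u v \<le> K / 2 ^ k"
  shows "exponential_connectivity_decay G p"
proof -
  let ?S = "\<lambda>m. Sup {ennreal (two_point G p u v) | u v. u \<in> verts G \<and> v \<in> verts G \<and> m \<le> graph_dist G u v}"
  \<comment> \<open>The extra \<open>ln 2\<close> pays for rounding: \<open>m div n\<close> is at
    least \<open>m / n - 1\<close>.\<close>
  let ?f = "\<lambda>m. 1 / real m * (ln K + ln 2) - ln 2 / real n"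
  \<comment> \<open>At \<open>m = 0\<close> the convention \<open>1 / 0 = 0\<close> makes the left
    side 0 while \<open>?f 0\<close> is negative; a single index does not affect the limsup.\<close>
  have le: "ereal (1 / real m) * log_ennreal (?S m) \<le> ereal (?f m)" if m: "m \<ge> 1" for m
  proof -
    have "?S m \<le> ennreal (K / 2 ^ (m div n))"
    proof (rule Sup_least)
      fix x assume "x \<in> {ennreal (two_point G p u v) | u v.
        u \<in> verts G \<and> v \<in> verts G \<and> m \<le> graph_dist G u v}"
      then obtain u v where uv: "x = ennreal (two_point G p u v)" "u \<in> verts G" "v \<in> verts G"
        "m \<le> graph_dist G u v" by blast
      moreover have "m div n * n \<le> m" by simp
      ultimately have "m div n * n \<le> graph_dist G u v" by linarith
      with uv show "x \<le> ennreal (K / 2 ^ (m div n))"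
        by (auto intro!: ennreal_leI bound)
    qed
    then have "log_ennreal (?S m) \<le> ereal (ln (K / 2 ^ (m div n)))"
      using K by (intro log_ennreal_le) auto
    also have "\<dots> = ereal (ln K - real (m div n) * ln 2)"
      using K by (simp add: ln_div ln_realpow)
    also have "\<dots> \<le> ereal (ln K - (real m / real n - 1) * ln 2)"
    proof -
      have "m = m div n * n + m mod n" "m mod n < n" using n by simp_all
      then have "m \<le> (m div n + 1) * n" by (metis add_le_cancel_left less_imp_le distrib_right mult_1)
      then have "real m \<le> (real (m div n) + 1) * real n"
        by (metis of_nat_le_iff of_nat_mult of_nat_add of_nat_1)
      then have "real m / real n - 1 \<le> real (m div n)" using n by (simp add: field_simps)
      then show ?thesis by (simp add: mult_right_mono)
    qed
    finally have "ereal (1 / real m) * log_ennreal (?S m) \<le>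
        ereal (1 / real m) * ereal (ln K - (real m / real n - 1) * ln 2)"
      by (rule ereal_mult_left_mono) simp
    also have "\<dots> = ereal (?f m)" using m n by (simp add: field_simps)
    finally show ?thesis .
  qed
  have "(?f \<longlongrightarrow> 0 * (ln K + ln 2) - ln 2 / real n) sequentially"
    by (intro tendsto_intros lim_1_over_n)
  then have lim: "((\<lambda>m. ereal (?f m)) \<longlongrightarrow> ereal (- (ln 2 / real n))) sequentially" by simp
  have "limsup (\<lambda>m. ereal (1 / real m) * log_ennreal (?S m)) \<le> limsup (\<lambda>m. ereal (?f m))"
    using le by (intro Limsup_mono eventually_sequentiallyI[of 1]) auto
  also have "\<dots> = ereal (- (ln 2 / real n))" by (rule lim_imp_Limsup[OF _ lim]) simp
  also have "\<dots> < 0" using n by simp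
  finally show ?thesis
    unfolding exponential_connectivity_decay_def decay_rate_def by (simp add: ereal_less_uminus_reorder)
qed

section \<open>The parameter p = 0 and the comparison of the critical values\<close>

lemma two_point_0:
  assumes "v \<in> verts G" "u \<noteq> v"
  shows "two_point G 0 u v = 0"
proof -
  interpret prob_space "bernoulli_percolation G 0" by (rule prob_space_bernoulli_percolation)
  \<comment> \<open>Each edge is almost surely closed, and there are only countably many
    edges.\<close>
  have "AE \<omega> in bernoulli_percolation G 0. \<forall>e\<in>edges G. \<not> \<omega> e"
    unfolding bernoulli_percolation_def
    by (intro AE_ball_countable' countable_edges AE_PiM_component prob_space_measure_pmf)
       (auto simp: AE_measure_pmf_iff set_pmf_iff)
  then have "AE \<omega> in bernoulli_percolation G 0. (u, v) \<notin> (open_adj (ends G) (edges G) \<omega>)\<^sup>*"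
  proof eventually_elim
    case (elim \<omega>)
    then have "open_adj (ends G) (edges G) \<omega> = {}" by (auto simp: open_adj_def)
    then show ?case using assms by simp
  qed
  then show ?thesis
    unfolding two_point_eq[OF assms(1)] using sets_connected[OF order_refl]
    by (simp add: prob_Collect_eq_0)
qed

text \<open>At parameter 0 the two-point matrix is the identity on the vertices. This makes the set
  in \<open>p_op\<close> nonempty, as a comparison of real suprema requires.\<close>

lemma op_norm_two_point_matrix_0: "op_norm (verts G) q (two_point_matrix G 0) < \<infinity>"
proof -
  have app: "mat_apply (verts G) (two_point_matrix G 0) f u = f u" if "u \<in> verts G" for f u
  proof -
    have "mat_apply (verts G) (two_point_matrix G 0) f u =
        (\<integral>\<^sup>+ v. f v * indicator {u} v \<partial>count_space (verts G))"
      unfolding mat_apply_def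
      by (intro nn_integral_cong)
        (auto simp: two_point_matrix_def two_point_0 two_point_self indicator_def)
    also have "\<dots> = f u" using that by (subst nn_integral_indicator_singleton) auto
    finally show ?thesis .
  qed
  have "Lq_norm (verts G) q (mat_apply (verts G) (two_point_matrix G 0) f) = Lq_norm (verts G) q f" for f
  proof -
    have "(\<integral>\<^sup>+ v. ennpowr (mat_apply (verts G) (two_point_matrix G 0) f v) r \<partial>count_space (verts G)) =
        (\<integral>\<^sup>+ v. ennpowr (f v) r \<partial>count_space (verts G))" for r
      by (intro nn_integral_cong) (simp add: app)
    then show ?thesis unfolding Lq_norm_def by (simp add: app cong: SUP_cong)
  qed
  moreover have "a / a \<le> 1" if "a < \<infinity>" for a :: ennreal
    using that by (cases "a = 0") auto
  ultimately have "op_norm (verts G) q (two_point_matrix G 0) \<le> 1"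
    unfolding op_norm_def by (intro Sup_least) auto
  then show ?thesis by (auto intro: le_less_trans)
qed

end

theorem theorem2p2:
  fixes G :: "('v, 'e) graph"
  assumes "graph G" and "connected_graph G" and "locally_finite_graph G"
  shows "p_op 2 G \<le> p_exp G"
proof -
  interpret percolation_graph G by unfold_locales (fact assms)+
  show ?thesis
    unfolding p_op_def p_exp_def
  proof (rule cSup_subset_mono)
    show "{p \<in> {0..1}. op_norm (verts G) 2 (two_point_matrix G p) < \<infinity>} \<noteq> {}"
      using op_norm_two_point_matrix_0 by (auto intro!: exI[of _ "0::real"])
    show "bdd_above {p \<in> {0..1}. exponential_connectivity_decay G p}"
      by (rule bdd_aboveI[of _ 1]) auto
    show "{p \<in> {0..1}. op_norm (verts G) 2 (two_point_matrix G p) < \<infinity>} \<subseteq>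
        {p \<in> {0..1}. exponential_connectivity_decay G p}"
      using two_point_exponential_bound exponential_connectivity_decayI by blast
  qed
qed

end
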